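(* Let $\theta,\vartheta$ be random variables (defined jointly) with values in $S^1$, put $\alpha_{k_1,k_2}:=\mathbb{E}[\theta^{k_1}\vartheta^{k_2}]$, let $x_1,x_2\in\mathbb{C}$ with $|x_i|<1$, and let $P(x_1,x_2)=\sum_{k_1,k_2=0}^\infty b_{k_1,k_2}x_1^{k_1}x_2^{k_2}$ be a polynomial with complex coefficients. If $b_{0,0}\notin\mathbb{Z}_{\le 0}$, then as $n\to\infty$ $$\mathbb{E}_n\left[W^1(P)(x_1,x_2)\right]\sim\frac{n^{b_{0,0}-1}}{\Gamma(b_{0,0})}\prod_{\substack{k_1,k_2\ge 0\\k_1+k_2\ne 0}}(1-x_1^{k_1}x_2^{k_2})^{-b_{k_1,k_2}\alpha_{k_1,k_2}}$$ and $$\mathbb{E}_n\left[W^2(P)(x_1,x_2)\right]\sim\frac{n^{b_{0,0}-1}}{\Gamma(b_{0,0})}\prod_{\substack{k_1,k_2\ge 0\\k_1+k_2\ne 0}}(1-\alpha_{k_1,k_2}x_1^{k_1}x_2^{k_2})^{-b_{k_1,k_2}}.$$ If $b_{0,0}\in\mathbb{Z}_{\le 0}$, then $\mathbb{E}_n[W^1(P)(x_1,x_2)]\to 0$ and $\mathbb{E}_n[W^2(P)(x_1,x_2)]\to 0$ as $n\to\infty$.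
   Context: $\mathcal{S}_n$ is the group of permutations of $\{1,\dots,n\}$; $\mathcal{C}_\lambda\subset\mathcal{S}_n$ is the set of permutations with cycle-type the partition $\lambda=(\lambda_1,\dots,\lambda_{l(\lambda)})$ of $n$ (the $\lambda_m\geq 1$ are the cycle lengths, $l(\lambda)$ is the number of cycles). Complex powers $z^s$ are defined with the principal branch of the logarithm on $\mathbb{C}\setminus\mathbb{R}_{\le 0}$. $a_n\sim b_n$ means $a_n/b_n\to1$. First randomized class function: for $g\in\mathcal{C}_\lambda$, $W^1(P)(x_1,x_2)(g):=\prod_{m=1}^{l(\lambda)}P(\theta_mx_1^{\lambda_m},\vartheta_mx_2^{\lambda_m})$, where the pairs $(\theta_m,\vartheta_m)$ are iid, distributed as $(\theta,\vartheta)$, and independent of $g$ (one pair per cycle). Second randomized class function: for $g\in\mathcal{C}_\lambda$, $W^2(P)(x_1,x_2)(g):=\prod_{m=1}^{l(\lambda)}P\big(x_1^{\lambda_m}\prod_{i=1}^{\lambda_m}\theta_i^{(m)},\,x_2^{\lambda_m}\prod_{i=1}^{\lambda_m}\vartheta_i^{(m)}\big)$, where the $n$ pairs $(\theta_i^{(m)},\vartheta_i^{(m)})$ are iid, distributed as $(\theta,\vartheta)$, and independent of $g$ (one pair per point). $\mathbb{E}_n[\cdot]$ denotes expectation over $g$ uniformly distributed on $\mathcal{S}_n$ and over the auxiliary random variables. *)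

theory Defs
  imports "HOL-Probability.Probability" "HOL-Combinatorics.Combinatorics"
    "HOL-Library.Landau_Symbols"
begin

definition sym_perms :: "nat \<Rightarrow> (nat \<Rightarrow> nat) set" where
  "sym_perms n = {g. g permutes {1..n}}"

text \<open>The cycles of a permutation are its orbits. The cycle type is the weakly decreasing list
  \<open>ls\<close> of the cycle lengths. Lists are indexed from \<open>0\<close>, so \<open>ls ! m\<close> is the part that is usually
  written with index \<open>m + 1\<close>, and \<open>length ls\<close> is the number of cycles.\<close>

definition cycle_type :: "nat \<Rightarrow> (nat \<Rightarrow> nat) \<Rightarrow> nat list" where
  "cycle_type n g = rev (sorted_list_of_multiset
     (image_mset card (mset_set (orbit g ` {1..n}))))"

text \<open>A polynomial in two variables is given by its array of coefficients, of which only finitely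
  many are nonzero (a hypothesis wherever these definitions are used).\<close>

definition coeff_supp :: "(nat \<Rightarrow> nat \<Rightarrow> complex) \<Rightarrow> (nat \<times> nat) set" where
  "coeff_supp b = {(k1, k2). b k1 k2 \<noteq> 0}"

definition poly2 :: "(nat \<Rightarrow> nat \<Rightarrow> complex) \<Rightarrow> complex \<Rightarrow> complex \<Rightarrow> complex" where
  "poly2 b y1 y2 = (\<Sum>(k1, k2)\<in>coeff_supp b. b k1 k2 * y1 ^ k1 * y2 ^ k2)"

text \<open>\<open>t m\<close> is the pair attached to the cycle with index \<open>m\<close>.\<close>

definition W1 :: "(nat \<Rightarrow> nat \<Rightarrow> complex) \<Rightarrow> complex \<Rightarrow> complex \<Rightarrow> nat \<Rightarrow> (nat \<Rightarrow> nat)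
    \<Rightarrow> (nat \<Rightarrow> complex \<times> complex) \<Rightarrow> complex" where
  "W1 b x1 x2 n g t = (let ls = cycle_type n g in
     \<Prod>m<length ls. poly2 b (fst (t m) * x1 ^ (ls ! m)) (snd (t m) * x2 ^ (ls ! m)))"

text \<open>\<open>t (m, i)\<close> is the pair attached to the point with index \<open>i\<close> of the cycle with index \<open>m\<close>.\<close>

definition W2 :: "(nat \<Rightarrow> nat \<Rightarrow> complex) \<Rightarrow> complex \<Rightarrow> complex \<Rightarrow> nat \<Rightarrow> (nat \<Rightarrow> nat)
    \<Rightarrow> (nat \<times> nat \<Rightarrow> complex \<times> complex) \<Rightarrow> complex" where
  "W2 b x1 x2 n g t = (let ls = cycle_type n g in
     \<Prod>m<length ls. poly2 b (x1 ^ (ls ! m) * (\<Prod>i<ls ! m. fst (t (m, i))))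
                             (x2 ^ (ls ! m) * (\<Prod>i<ls ! m. snd (t (m, i)))))"

definition joint_law :: "'a measure \<Rightarrow> ('a \<Rightarrow> complex) \<Rightarrow> ('a \<Rightarrow> complex)
    \<Rightarrow> (complex \<times> complex) measure" where
  "joint_law M \<theta> \<eta> = distr M borel (\<lambda>\<omega>. (\<theta> \<omega>, \<eta> \<omega>))"

text \<open>A uniformly distributed permutation together with an independent family, indexed by \<open>I\<close>,
  of iid pairs with the joint law of \<open>(\<theta>, \<eta>)\<close>.\<close>

definition rand_space :: "nat \<Rightarrow> 'i set \<Rightarrow> 'a measure \<Rightarrow> ('a \<Rightarrow> complex) \<Rightarrow> ('a \<Rightarrow> complex)
    \<Rightarrow> ((nat \<Rightarrow> nat) \<times> ('i \<Rightarrow> complex \<times> complex)) measure" where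
  "rand_space n I M \<theta> \<eta> =
     uniform_count_measure (sym_perms n) \<Otimes>\<^sub>M (\<Pi>\<^sub>M i\<in>I. joint_law M \<theta> \<eta>)"

text \<open>A permutation of \<open>n\<close> points has at most \<open>n\<close> cycles, each of length at most \<open>n\<close>, so the index
  sets below contain every index that occurs in \<open>W1\<close> and \<open>W2\<close>. Given \<open>g\<close>, exactly one pair per
  cycle enters \<open>W1\<close> and exactly one pair per point enters \<open>W2\<close>, that is, \<open>n\<close> pairs; the remaining
  pairs are not used.\<close>

definition E1 :: "'a measure \<Rightarrow> ('a \<Rightarrow> complex) \<Rightarrow> ('a \<Rightarrow> complex)
    \<Rightarrow> (nat \<Rightarrow> nat \<Rightarrow> complex) \<Rightarrow> complex \<Rightarrow> complex \<Rightarrow> nat \<Rightarrow> complex" where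
  "E1 M \<theta> \<eta> b x1 x2 n = (\<integral>(g, t). W1 b x1 x2 n g t \<partial>rand_space n {..<n} M \<theta> \<eta>)"

definition E2 :: "'a measure \<Rightarrow> ('a \<Rightarrow> complex) \<Rightarrow> ('a \<Rightarrow> complex)
    \<Rightarrow> (nat \<Rightarrow> nat \<Rightarrow> complex) \<Rightarrow> complex \<Rightarrow> complex \<Rightarrow> nat \<Rightarrow> complex" where
  "E2 M \<theta> \<eta> b x1 x2 n =
     (\<integral>(g, t). W2 b x1 x2 n g t \<partial>rand_space n ({..<n} \<times> {..<n}) M \<theta> \<eta>)"

definition joint_moment :: "'a measure \<Rightarrow> ('a \<Rightarrow> complex) \<Rightarrow> ('a \<Rightarrow> complex)
    \<Rightarrow> nat \<Rightarrow> nat \<Rightarrow> complex" where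
  "joint_moment M \<theta> \<eta> k1 k2 = (\<integral>\<omega>. \<theta> \<omega> ^ k1 * \<eta> \<omega> ^ k2 \<partial>M)"

end

theory Submission
  imports Defs "HOL-Computational_Algebra.Formal_Power_Series"
begin

text \<open>Both expectations are averages over the symmetric group of a product over cycles. Given the
  permutation, the factors that belong to distinct cycles are independent, so the conditional
  expectation is \<open>\<Prod>m. c (\<lambda>\<^sub>m)\<close> for a deterministic sequence \<open>c\<close>: a cycle of length \<open>l\<close> contributes
  \<open>c l = (\<Sum>k. b\<^sub>k * \<alpha>\<^sub>k * (x1 ^ k1 * x2 ^ k2) ^ l)\<close> in the first model and
  \<open>c l = (\<Sum>k. b\<^sub>k * (\<alpha>\<^sub>k * x1 ^ k1 * x2 ^ k2) ^ l)\<close> in the second, where \<open>k = (k1, k2)\<close>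
  (\<open>E1_eq\<close>, \<open>E2_eq\<close>). In both cases \<open>c l = (\<Sum>j. \<beta>\<^sub>j * r\<^sub>j ^ l)\<close>, where the index \<open>(0, 0)\<close> has
  \<open>r = 1\<close> and \<open>\<beta> = b\<^sub>0\<^sub>0\<close>, and \<open>\<bar>r\<^sub>j\<bar> < 1\<close> for every other index, because
  \<open>\<bar>\<alpha>\<^sub>k\<bar> \<le> 1\<close> and \<open>\<bar>x1\<bar>, \<bar>x2\<bar> < 1\<close>.

  The means \<open>e n\<close> of \<open>\<Prod>m. c (\<lambda>\<^sub>m)\<close> satisfy \<open>n * e n = (\<Sum>k=1..n. c k * e (n - k))\<close>, the
  sum running over the length of the cycle of a chosen point (\<open>sum_cycle_weight\<close>). The product of
  binomial series \<open>F(z) = (\<Prod>j. (1 - r\<^sub>j * z) powr - \<beta>\<^sub>j)\<close> has coefficients with the same recurrence,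
  by logarithmic differentiation (\<open>prod_binom_fps_recurrence\<close>), so \<open>F\<close> is the generating function
  of \<open>e\<close>.

  Write \<open>F(z) = (1 - z) powr - b\<^sub>0\<^sub>0 * H(z)\<close>. The coefficients \<open>a n\<close> of the first factor are
  equivalent to \<open>n powr (b\<^sub>0\<^sub>0 - 1) / Gamma b\<^sub>0\<^sub>0\<close>, and \<open>H\<close> converges in a disc of radius larger
  than \<open>1\<close>. Therefore the convolution of \<open>a\<close> with the coefficients of \<open>H\<close> is equivalent to
  \<open>a n * H(1)\<close>, by dominated convergence (\<open>convolution_ratio_tendsto\<close>). When
  \<open>b\<^sub>0\<^sub>0\<close> is a nonpositive integer, the first factor is a polynomial and the convolution tends
  to \<open>0\<close> together with the coefficients of \<open>H\<close>.\<close>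

section \<open>Cycle-multiplicative weights on permutations\<close>

text \<open>Composing with the transposition of a new point \<open>a\<close> and a point \<open>b\<close> inserts \<open>a\<close> into the
  cycle of \<open>b\<close>, directly before \<open>b\<close>, and leaves the other cycles alone.\<close>

lemma orbit_transpose_comp:
  assumes S: "finite S" "a \<notin> S" "p permutes S" "b \<in> S"
  shows "orbit (Transposition.transpose a b \<circ> p) a = insert a (orbit p b)"
    and "\<And>y. y \<in> S \<Longrightarrow> y \<notin> orbit p b \<Longrightarrow> orbit (Transposition.transpose a b \<circ> p) y = orbit p y"
    and "\<And>y. y \<in> orbit p b \<Longrightarrow> orbit (Transposition.transpose a b \<circ> p) y = insert a (orbit p b)"
proof -
  let ?g = "Transposition.transpose a b \<circ> p"
  have pa: "p a = a" using S by (simp add: permutes_not_in)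
  have ga: "?g a = b" by (simp add: pa)
  have perm_p: "permutation p" using S by (auto simp: permutation_permutes)
  have g: "?g permutes insert a S"
    using S by (intro permutes_compose permutes_swap_id permutes_subset[OF S(3)]) auto
  then have perm_g: "permutation ?g" using S by (auto simp: permutation_permutes)
  have bb: "b \<in> orbit p b" using perm_p by (rule permutation_self_in_orbit)
  have sub: "orbit p y \<subseteq> S" if "y \<in> S" for y
    using permutes_orbit_subset[OF S(3) that] .
  have aa: "a \<in> orbit ?g a" using perm_g by (rule permutation_self_in_orbit)
  show A: "orbit ?g a = insert a (orbit p b)"
  proof
    show "orbit ?g a \<subseteq> insert a (orbit p b)"
    proof
      fix z assume "z \<in> orbit ?g a"
      then show "z \<in> insert a (orbit p b)"
      proof induction
        case base then show ?case using bb by (simp add: pa)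
      next
        case (step y)
        then consider "y = a" | "y \<in> orbit p b" by blast
        then show ?case
        proof cases
          case 1 then show ?thesis using bb by (simp add: pa)
        next
          case 2
          then have "p y \<in> orbit p b" by (rule orbit.step)
          then show ?thesis using bb sub[OF S(4)] S(2)
            by (auto simp: Transposition.transpose_def)
        qed
      qed
    qed
    have bg: "b \<in> orbit ?g a" using orbit.base[of ?g a] by (simp only: ga)
    have pz: "p z \<in> orbit ?g a" if "z \<in> orbit ?g a" "z \<in> orbit p b" for z
    proof (cases "p z = b")
      case True
      then show ?thesis using bg by simp
    next
      case False
      have "p z \<noteq> a" using orbit.step[OF that(2)] sub[OF S(4)] S(2) by auto
      then have "?g z = p z" using False by (simp add: Transposition.transpose_def)
      then show ?thesis using orbit.step[OF that(1)] by metis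
    qed
    have "z \<in> orbit ?g a" if "z \<in> orbit p b" for z
      using that
    proof induction
      case base
      show ?case using bg bb by (rule pz)
    next
      case (step y)
      show ?case using step(2,1) by (rule pz)
    qed
    then show "insert a (orbit p b) \<subseteq> orbit ?g a" using aa by auto
  qed
  show "orbit ?g y = insert a (orbit p b)" if "y \<in> orbit p b" for y
  proof -
    have y: "y \<in> orbit ?g a" using that A by simp
    have "cyclic_on ?g (orbit ?g a)"
      using perm_g by (simp add: cyclic_on_orbit')
    then show ?thesis using orbit_cyclic_eq3[OF _ y] A by simp
  qed
  show "orbit ?g y = orbit p y" if y: "y \<in> S" "y \<notin> orbit p b" for y
  proof (rule orbit_cong)
    fix z assume z: "z \<in> orbit p y"
    have "p z \<in> orbit p y" using z by (rule orbit.step)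
    moreover have "b \<notin> orbit p y"
      using y orbit_swap[OF bb] permutation_self_in_orbit[OF perm_p, of y]
      by (metis orbit_swap)
    moreover have "a \<notin> orbit p y" using sub[OF y(1)] S(2) by auto
    ultimately show "?g z = p z" by (auto simp: Transposition.transpose_def)
  qed (rule permutation_self_in_orbit[OF perm_p])
qed

text \<open>The product of \<open>c\<close> over the cycle lengths of \<open>p\<close>, a permutation of \<open>S\<close>. The cycles are
  taken as a set of orbits, which is faithful because distinct cycles are disjoint.\<close>

definition cycle_weight :: "(nat \<Rightarrow> 'b::comm_ring_1) \<Rightarrow> 'a set \<Rightarrow> ('a \<Rightarrow> 'a) \<Rightarrow> 'b" where
  "cycle_weight c S p = (\<Prod>A\<in>orbit p ` S. c (card A))"

text \<open>The same product, except that the cycle of \<open>x\<close> is weighted as if it were longer by \<open>j\<close>. With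
  this extra parameter, removing one point from the cycle of \<open>x\<close> reduces the sum over all
  permutations of \<open>S\<close> to sums of the same kind over a set with one point less.\<close>

definition pinned_weight ::
    "(nat \<Rightarrow> 'b::comm_ring_1) \<Rightarrow> 'a set \<Rightarrow> 'a \<Rightarrow> nat \<Rightarrow> ('a \<Rightarrow> 'a) \<Rightarrow> 'b" where
  "pinned_weight c S x j p =
     c (card (orbit p x) + j) * (\<Prod>A\<in>orbit p ` S - {orbit p x}. c (card A))"

lemma pinned_weight_0:
  assumes "finite S" "x \<in> S"
  shows "pinned_weight c S x 0 p = cycle_weight c S p"
  unfolding pinned_weight_def cycle_weight_def using assms
  by (subst prod.remove[of "orbit p ` S" "orbit p x"]) auto

lemma pinned_weight_insert_self:
  assumes "finite S" "a \<notin> S" "p permutes S"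
  shows "pinned_weight c (insert a S) a j p = c (Suc j) * cycle_weight c S p"
proof -
  have "p a = a" using assms by (simp add: permutes_not_in)
  then have oa: "orbit p a = {a}" by (simp add: orbit_eq_singleton_iff)
  have "{a} \<notin> orbit p ` S"
    using permutes_orbit_subset[OF assms(3)] assms(2) by blast
  then have "orbit p ` insert a S - {orbit p a} = orbit p ` S" using oa by auto
  then show ?thesis by (simp add: pinned_weight_def cycle_weight_def oa)
qed

lemma pinned_weight_insert_other:
  assumes "finite S" "a \<notin> S" "p permutes S" "b \<in> S"
  shows "pinned_weight c (insert a S) a j (Transposition.transpose a b \<circ> p) = pinned_weight c S b (Suc j) p"
proof -
  let ?g = "Transposition.transpose a b \<circ> p"
  note o = orbit_transpose_comp[OF assms]
  have sub: "orbit p y \<subseteq> S" if "y \<in> S" for y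
    using permutes_orbit_subset[OF assms(3) that] .
  have fin: "finite (orbit p b)" using sub[OF assms(4)] assms(1) finite_subset by blast
  have anot: "a \<notin> orbit p b" using sub[OF assms(4)] assms(2) by auto
  have perm_p: "permutation p" using assms by (auto simp: permutation_permutes)
  have eqo: "orbit p y = orbit p b" if "y \<in> orbit p b" for y
    using perm_p that by (intro orbit_cyclic_eq3) (simp_all add: cyclic_on_orbit')
  have self: "y \<in> orbit p y" for y using perm_p by (rule permutation_self_in_orbit)
  have "orbit ?g ` insert a S - {orbit ?g a} = orbit p ` S - {orbit p b}" (is "?L = ?R")
  proof
    show "?L \<subseteq> ?R"
    proof
      fix B assume "B \<in> ?L"
      then obtain y where y: "y \<in> S" "B = orbit ?g y" "B \<noteq> insert a (orbit p b)"
        using o(1) by auto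
      then have "y \<notin> orbit p b" using o(3) by auto
      then show "B \<in> ?R" using y o(2)[of y] self[of y] by auto
    qed
    show "?R \<subseteq> ?L"
    proof
      fix B assume "B \<in> ?R"
      then obtain y where y: "y \<in> S" "B = orbit p y" "B \<noteq> orbit p b" by auto
      then have "y \<notin> orbit p b" using eqo by auto
      then have "B = orbit ?g y" using y o(2)[of y] by simp
      moreover have "B \<noteq> insert a (orbit p b)" using y sub[OF y(1)] assms(2) by auto
      ultimately show "B \<in> ?L" using y o(1) by auto
    qed
  qed
  moreover have "card (orbit ?g a) = Suc (card (orbit p b))"
    using o(1) fin anot by simp
  ultimately show ?thesis by (simp add: pinned_weight_def)
qed

text \<open>The permutations of \<open>insert a S\<close> are sorted by the successor of \<open>a\<close>: it is \<open>a\<close> itself, or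
  a point \<open>b\<close> of \<open>S\<close>, and then deleting \<open>a\<close> transfers the pinning to \<open>b\<close>.\<close>

lemma sum_pinned_weight_insert:
  assumes "finite S" "a \<notin> S"
  shows "(\<Sum>g | g permutes insert a S. pinned_weight c (insert a S) a j g) =
    c (Suc j) * (\<Sum>p | p permutes S. cycle_weight c S p) +
    (\<Sum>b\<in>S. \<Sum>p | p permutes S. pinned_weight c S b (Suc j) p)"
proof -
  have "(\<Sum>g | g permutes insert a S. pinned_weight c (insert a S) a j g) =
      (\<Sum>p | p permutes S. pinned_weight c (insert a S) a j p) +
      (\<Sum>b\<in>S. \<Sum>p | p permutes S. pinned_weight c (insert a S) a j (Transposition.transpose a b \<circ> p))"
    using assms by (simp add: sum_over_permutations_insert)
  also have "(\<Sum>p | p permutes S. pinned_weight c (insert a S) a j p) =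
      c (Suc j) * (\<Sum>p | p permutes S. cycle_weight c S p)"
    unfolding sum_distrib_left
    using assms by (intro sum.cong) (auto simp: pinned_weight_insert_self)
  also have "(\<Sum>b\<in>S. \<Sum>p | p permutes S. pinned_weight c (insert a S) a j (Transposition.transpose a b \<circ> p)) =
      (\<Sum>b\<in>S. \<Sum>p | p permutes S. pinned_weight c S b (Suc j) p)"
    using assms by (intro sum.cong) (auto simp: pinned_weight_insert_other)
  finally show ?thesis .
qed

text \<open>The induction carries along the pinned sums, for every shift \<open>j\<close>: they are
  \<open>(n - 1)!\<close> times the convolution of the shifted sequence \<open>c\<close> with \<open>e\<close>.\<close>

lemma sum_cycle_weight:
  fixes c e :: "nat \<Rightarrow> 'b::{comm_ring_1,ring_char_0}"
  assumes e0: "e 0 = 1"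
    and e: "\<And>n. of_nat (Suc n) * e (Suc n) = (\<Sum>k\<le>n. c (Suc k) * e (n - k))"
    and S: "finite S"
  shows "(\<Sum>g | g permutes S. cycle_weight c S g) = fact (card S) * e (card S)"
proof -
  have main: "finite S \<Longrightarrow> card S = n \<Longrightarrow>
      (\<Sum>g | g permutes S. cycle_weight c S g) = fact n * e n \<and>
      (\<forall>x\<in>S. \<forall>j. (\<Sum>g | g permutes S. pinned_weight c S x j g) =
          fact (n - 1) * (\<Sum>k<n. c (Suc k + j) * e (n - Suc k)))" for S :: "'a set" and n
  proof (induction n arbitrary: S)
    case 0
    then show ?case by (simp add: cycle_weight_def e0)
  next
    case (Suc n)
    have pinned: "(\<Sum>g | g permutes S. pinned_weight c S x j g) =
        fact n * (\<Sum>k\<le>n. c (Suc k + j) * e (n - k))" if x: "x \<in> S" for x j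
    proof -
      define T where "T = S - {x}"
      have T: "finite T" "x \<notin> T" "S = insert x T" "card T = n"
        using Suc.prems x by (auto simp: T_def)
      note IH = Suc.IH[OF T(1,4)]
      have "(\<Sum>g | g permutes S. pinned_weight c S x j g) =
          c (Suc j) * (fact n * e n) +
          of_nat n * (fact (n - 1) * (\<Sum>k<n. c (Suc k + Suc j) * e (n - Suc k)))"
        using IH T by (simp add: sum_pinned_weight_insert)
      also have "of_nat n * (fact (n - 1) * (\<Sum>k<n. c (Suc k + Suc j) * e (n - Suc k))) =
          fact n * (\<Sum>k<n. c (Suc k + Suc j) * e (n - Suc k))"
        by (cases n) (simp_all add: algebra_simps)
      also have "(\<Sum>k\<le>n. c (Suc k + j) * e (n - k)) =
          c (Suc j) * e n + (\<Sum>k<n. c (Suc k + Suc j) * e (n - Suc k))"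
        unfolding sum.atMost_shift by simp
      then have "c (Suc j) * (fact n * e n) +
          fact n * (\<Sum>k<n. c (Suc k + Suc j) * e (n - Suc k)) =
          fact n * (\<Sum>k\<le>n. c (Suc k + j) * e (n - k))"
        by (simp add: algebra_simps)
      finally show ?thesis .
    qed
    from Suc.prems obtain x where x: "x \<in> S" by fastforce
    have "(\<Sum>g | g permutes S. cycle_weight c S g) =
        (\<Sum>g | g permutes S. pinned_weight c S x 0 g)"
      using pinned_weight_0[OF Suc.prems(1) x, of c] by simp
    also have "\<dots> = fact n * (of_nat (Suc n) * e (Suc n))"
      unfolding pinned[OF x] e by simp
    also have "\<dots> = fact (Suc n) * e (Suc n)" by (simp add: algebra_simps)
    finally show ?case using pinned by (simp add: lessThan_Suc_atMost)
  qed
  show ?thesis using main[OF S refl] by simp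
qed

section \<open>Products of binomial series\<close>

unbundle no vec_syntax
unbundle fps_syntax

text \<open>The formal power series of \<open>(1 - r * z) powr - \<beta>\<close>.\<close>

definition binom_fps :: "'a::field_char_0 \<Rightarrow> 'a \<Rightarrow> 'a fps" where
  "binom_fps r \<beta> = Abs_fps (\<lambda>n. (- \<beta> gchoose n) * (- r) ^ n)"

lemma binom_fps_nth_0 [simp]: "binom_fps r \<beta> $ 0 = 1"
  by (simp add: binom_fps_def)

lemma gbinomial_Suc_mult:
  fixes a :: "'a::field_char_0"
  shows "of_nat (Suc n) * (a gchoose Suc n) = (a - of_nat n) * (a gchoose n)"
  using gbinomial_mult_1[of a n] by (simp add: algebra_simps)

text \<open>The logarithmic derivative is \<open>\<beta> * r / (1 - r * z)\<close>, expanded as a geometric series.\<close>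

lemma fps_deriv_binom_fps:
  "fps_deriv (binom_fps r \<beta>) = Abs_fps (\<lambda>n. \<beta> * r ^ Suc n) * binom_fps r \<beta>"
proof -
  let ?L = "1 - fps_const r * fps_X"
  have "?L * fps_deriv (binom_fps r \<beta>) = fps_const (\<beta> * r) * binom_fps r \<beta>"
  proof (rule fps_ext)
    fix n
    have S: "of_nat (Suc m) * (- \<beta> gchoose Suc m) = - ((\<beta> + of_nat m) * (- \<beta> gchoose m))" for m
      by (simp only: gbinomial_Suc_mult) (simp add: algebra_simps)
    have rec: "of_nat (Suc m) * binom_fps r \<beta> $ Suc m = r * (\<beta> + of_nat m) * binom_fps r \<beta> $ m"
      for m
    proof -
      have "of_nat (Suc m) * binom_fps r \<beta> $ Suc m =
          (of_nat (Suc m) * (- \<beta> gchoose Suc m)) * (- r) ^ Suc m"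
        by (simp add: binom_fps_def)
      also have "\<dots> = - ((\<beta> + of_nat m) * (- \<beta> gchoose m)) * (- r) ^ Suc m"
        by (simp only: S)
      finally show ?thesis by (simp add: binom_fps_def)
    qed
    show "(?L * fps_deriv (binom_fps r \<beta>)) $ n = (fps_const (\<beta> * r) * binom_fps r \<beta>) $ n"
    proof (cases n)
      case 0
      then show ?thesis using rec[of 0] by (simp add: left_diff_distrib mult.assoc)
    next
      case (Suc m)
      have "(?L * fps_deriv (binom_fps r \<beta>)) $ n =
          of_nat (Suc n) * binom_fps r \<beta> $ Suc n - r * (of_nat n * binom_fps r \<beta> $ n)"
        using Suc by (simp add: left_diff_distrib mult.assoc)
      then show ?thesis unfolding rec by (simp add: algebra_simps)
    qed
  qed
  also have "fps_const (\<beta> * r) = ?L * Abs_fps (\<lambda>n. \<beta> * r ^ Suc n)"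
  proof (rule fps_ext)
    fix n
    show "fps_const (\<beta> * r) $ n = (?L * Abs_fps (\<lambda>n. \<beta> * r ^ Suc n)) $ n"
      by (cases n) (simp_all add: left_diff_distrib mult.assoc)
  qed
  finally have "?L * fps_deriv (binom_fps r \<beta>) = ?L * (Abs_fps (\<lambda>n. \<beta> * r ^ Suc n) * binom_fps r \<beta>)"
    by (simp add: mult.assoc)
  moreover have "?L \<noteq> 0"
  proof
    assume "?L = 0"
    then have "?L $ 0 = 0 $ 0" by (rule arg_cong)
    then show False by simp
  qed
  ultimately show ?thesis by simp
qed

lemma fps_deriv_prod_binom_fps:
  assumes "finite J"
  shows "fps_deriv (\<Prod>j\<in>J. binom_fps (r j) (\<beta> j)) =
    Abs_fps (\<lambda>n. \<Sum>j\<in>J. \<beta> j * r j ^ Suc n) * (\<Prod>j\<in>J. binom_fps (r j) (\<beta> j))"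
  using assms
proof (induction J rule: finite_induct)
  case empty
  then show ?case by (simp add: fps_zero_def[symmetric])
next
  case (insert i J)
  have "Abs_fps (\<lambda>n. \<Sum>j\<in>insert i J. \<beta> j * r j ^ Suc n) =
      Abs_fps (\<lambda>n. \<beta> i * r i ^ Suc n) + Abs_fps (\<lambda>n. \<Sum>j\<in>J. \<beta> j * r j ^ Suc n)"
    using insert by (intro fps_ext) simp
  then show ?case using insert by (simp add: fps_deriv_binom_fps algebra_simps)
qed

lemma prod_binom_fps_recurrence:
  fixes r \<beta> :: "'j \<Rightarrow> 'a::field_char_0"
  assumes "finite J"
  defines "F \<equiv> \<Prod>j\<in>J. binom_fps (r j) (\<beta> j)"
  shows "F $ 0 = 1"
    and "of_nat (Suc n) * F $ Suc n = (\<Sum>k\<le>n. (\<Sum>j\<in>J. \<beta> j * r j ^ Suc k) * F $ (n - k))"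
proof -
  show "F $ 0 = 1" unfolding F_def using assms(1)
    by (induction J rule: finite_induct) auto
  have "of_nat (Suc n) * F $ Suc n = fps_deriv F $ n" by simp
  also have "\<dots> = (\<Sum>k\<le>n. (\<Sum>j\<in>J. \<beta> j * r j ^ Suc k) * F $ (n - k))"
    unfolding F_def fps_deriv_prod_binom_fps[OF assms(1)]
    by (simp add: fps_mult_nth atLeast0AtMost)
  finally show "of_nat (Suc n) * F $ Suc n = (\<Sum>k\<le>n. (\<Sum>j\<in>J. \<beta> j * r j ^ Suc k) * F $ (n - k))" .
qed

lemma binom_fps_sums:
  fixes r \<beta> :: complex
  assumes "norm (r * z) < 1"
  shows "(\<lambda>n. binom_fps r \<beta> $ n * z ^ n) sums (1 - r * z) powr (- \<beta>)"
proof -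
  have "(\<lambda>n. (- \<beta> gchoose n) * (- (r * z)) ^ n) sums (1 + - (r * z)) powr (- \<beta>)"
    by (rule gen_binomial_complex) (use assms in simp)
  also have "(\<lambda>n. (- \<beta> gchoose n) * (- (r * z)) ^ n) = (\<lambda>n. binom_fps r \<beta> $ n * z ^ n)"
    by (simp add: binom_fps_def fun_eq_iff flip: power_mult_distrib)
  finally show ?thesis by simp
qed

text \<open>Convergence at a point of larger modulus gives absolute convergence.\<close>

lemma binom_fps_summable_norm:
  fixes r \<beta> :: complex
  assumes "norm (r * z) < 1"
  shows "summable (\<lambda>n. norm (binom_fps r \<beta> $ n * z ^ n))"
proof -
  define w where "w = complex_of_real ((norm (r * z) + 1) / 2)"
  have w: "norm (r * z) < norm w" "norm w < 1"
    using assms by (auto simp: w_def simp del: of_real_add of_real_divide)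
  have "summable (\<lambda>n. binom_fps 1 \<beta> $ n * w ^ n)"
    using binom_fps_sums[of 1 w \<beta>] w by (auto simp: sums_iff)
  from powser_insidea[OF this w(1)]
  show ?thesis
    by (simp add: binom_fps_def norm_mult norm_power mult_ac power_mult_distrib)
qed

lemma prod_binom_fps_sums:
  fixes r \<beta> :: "'j \<Rightarrow> complex"
  assumes "finite J" "\<And>j. j \<in> J \<Longrightarrow> norm (r j * z) < 1"
  defines "F \<equiv> \<Prod>j\<in>J. binom_fps (r j) (\<beta> j)"
  shows "summable (\<lambda>n. norm (F $ n * z ^ n))"
    and "(\<lambda>n. F $ n * z ^ n) sums (\<Prod>j\<in>J. (1 - r j * z) powr (- \<beta> j))"
proof -
  have "summable (\<lambda>n. norm (F $ n * z ^ n)) \<and>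
      (\<lambda>n. F $ n * z ^ n) sums (\<Prod>j\<in>J. (1 - r j * z) powr (- \<beta> j))"
    unfolding F_def using assms(1,2)
  proof (induction J rule: finite_induct)
    case empty
    have "(\<lambda>n. (1::complex fps) $ n * z ^ n) = (\<lambda>n. if n = 0 then 1 else 0)"
      and "(\<lambda>n. norm ((1::complex fps) $ n * z ^ n)) = (\<lambda>n. if n = 0 then 1 else 0)"
      by (auto simp: fun_eq_iff)
    then show ?case
      using sums_single[of 0 "\<lambda>_. 1::complex"] sums_single[of 0 "\<lambda>_. 1::real"]
      by (simp add: sums_iff)
  next
    case (insert i J)
    let ?G = "binom_fps (r i) (\<beta> i)" and ?H = "\<Prod>j\<in>J. binom_fps (r j) (\<beta> j)"
    let ?a = "\<lambda>n. ?G $ n * z ^ n" and ?b = "\<lambda>n. ?H $ n * z ^ n"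
    have a: "summable (\<lambda>n. norm (?a n))" "?a sums (1 - r i * z) powr (- \<beta> i)"
      using insert by (auto intro!: binom_fps_summable_norm binom_fps_sums)
    have b: "summable (\<lambda>n. norm (?b n))" "?b sums (\<Prod>j\<in>J. (1 - r j * z) powr (- \<beta> j))"
      using insert by auto
    have conv: "(\<Sum>k\<le>n. ?a k * ?b (n - k)) = (?G * ?H) $ n * z ^ n" for n
      unfolding fps_mult_nth sum_distrib_right atLeast0AtMost
      by (intro sum.cong refl) (simp add: mult_ac flip: power_add)
    have conv': "norm ((?G * ?H) $ n * z ^ n) \<le> (\<Sum>k\<le>n. norm (?a k) * norm (?b (n - k)))" for n
      unfolding conv[symmetric] norm_mult[symmetric] by (rule norm_sum)
    have "summable (\<lambda>n. \<Sum>k\<le>n. norm (?a k) * norm (?b (n - k)))"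
      using a b by (intro summable_Cauchy_product) auto
    then have "summable (\<lambda>n. norm ((?G * ?H) $ n * z ^ n))"
      by (rule summable_comparison_test'[of _ 0]) (use conv' in simp)
    moreover have "(\<lambda>n. (?G * ?H) $ n * z ^ n) sums
        ((1 - r i * z) powr (- \<beta> i) * (\<Prod>j\<in>J. (1 - r j * z) powr (- \<beta> j)))"
      using Cauchy_product_sums[OF a(1) b(1)] a(2) b(2) unfolding conv by (simp add: sums_iff)
    ultimately show ?case using insert by simp
  qed
  then show "summable (\<lambda>n. norm (F $ n * z ^ n))"
    and "(\<lambda>n. F $ n * z ^ n) sums (\<Prod>j\<in>J. (1 - r j * z) powr (- \<beta> j))" by auto
qed

section \<open>Asymptotics of a convolution\<close>

lemma tendsto_ratio_shift:
  fixes a :: "nat \<Rightarrow> complex"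
  assumes nz: "\<And>n. a n \<noteq> 0" and lim: "(\<lambda>n. a n / a (Suc n)) \<longlonglongrightarrow> 1"
  shows "(\<lambda>n. a (n - k) / a n) \<longlonglongrightarrow> 1"
proof -
  have "(\<lambda>n. a n / a (n + k)) \<longlonglongrightarrow> 1"
  proof (induction k)
    case 0
    then show ?case using nz by simp
  next
    case (Suc k)
    have "(\<lambda>n. a (n + k) / a (Suc (n + k))) \<longlonglongrightarrow> 1"
      using LIMSEQ_ignore_initial_segment[OF lim, of k] by simp
    from tendsto_mult[OF Suc this] show ?case using nz by simp
  qed
  then have "(\<lambda>n. a (n + k - k) / a (n + k)) \<longlonglongrightarrow> 1" by simp
  then show ?thesis by (rule LIMSEQ_offset)
qed

text \<open>For \<open>q > 1\<close> the sequence \<open>norm (a n) * q ^ n\<close> is eventually increasing, and the finitely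
  many terms before that are absorbed into the constant. This is the majorant for the dominated
  convergence below.\<close>

lemma ratio_geometric_bound:
  fixes a :: "nat \<Rightarrow> complex"
  assumes nz: "\<And>n. a n \<noteq> 0" and lim: "(\<lambda>n. a n / a (Suc n)) \<longlonglongrightarrow> 1" and q: "q > 1"
  obtains C N where "\<And>n k. n \<ge> N \<Longrightarrow> k \<le> n \<Longrightarrow> norm (a (n - k) / a n) \<le> C * q ^ k"
proof -
  define u where "u = (\<lambda>n. norm (a n) * q ^ n)"
  have u_pos: "u n > 0" for n using nz q by (simp add: u_def)
  have "(\<lambda>n. norm (a n / a (Suc n))) \<longlonglongrightarrow> norm (1::complex)" using lim by (rule tendsto_norm)
  then have "eventually (\<lambda>n. norm (a n / a (Suc n)) < q) sequentially"
    using q by (intro order_tendstoD) auto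
  then obtain N where N: "\<And>n. n \<ge> N \<Longrightarrow> norm (a n / a (Suc n)) < q"
    by (auto simp: eventually_sequentially)
  have step_le: "u n \<le> u (Suc n)" if "n \<ge> N" for n
  proof -
    have "norm (a n) \<le> q * norm (a (Suc n))"
      using N[OF that] nz[of "Suc n"] by (simp add: norm_divide divide_simps)
    then have "norm (a n) * q ^ n \<le> (q * norm (a (Suc n))) * q ^ n"
      using q by (intro mult_right_mono) auto
    then show ?thesis by (simp add: u_def mult_ac)
  qed
  have mono: "u j \<le> u n" if "N \<le> j" "j \<le> n" for j n
    using that(2)
  proof (induction rule: dec_induct)
    case (step m)
    then show ?case using step_le[of m] that(1) by simp
  qed simp
  define C where "C = 1 + (\<Sum>i<N. u i / u N)"
  have C: "u j \<le> C * u n" if "j \<le> n" "N \<le> n" for j n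
  proof (cases "N \<le> j")
    case True
    have "0 \<le> (\<Sum>i<N. u i / u N)" using u_pos by (intro sum_nonneg) (simp add: less_imp_le)
    then have "1 * u n \<le> C * u n" using u_pos[of n] by (intro mult_right_mono) (auto simp: C_def)
    then show ?thesis using mono[OF True that(1)] by simp
  next
    case False
    then have "u j / u N \<le> (\<Sum>i<N. u i / u N)"
      using u_pos by (intro member_le_sum) (auto simp: less_imp_le)
    then have "u j \<le> C * u N" using u_pos[of N] by (simp add: C_def divide_simps algebra_simps)
    also have "\<dots> \<le> C * u n"
    proof -
      have "0 \<le> (\<Sum>i<N. u i / u N)" using u_pos by (intro sum_nonneg) (simp add: less_imp_le)
      then show ?thesis using mono[of N n] that by (intro mult_left_mono) (auto simp: C_def)
    qed
    finally show ?thesis .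
  qed
  show ?thesis
  proof (rule that[of N C])
    fix n k :: nat assume nk: "n \<ge> N" "k \<le> n"
    have "norm (a (n - k)) * q ^ (n - k) \<le> C * (norm (a n) * q ^ n)"
      using C[of "n - k" n] nk by (simp add: u_def)
    also have "q ^ n = q ^ k * q ^ (n - k)" using nk by (simp flip: power_add)
    finally have "norm (a (n - k)) * q ^ (n - k) \<le> (C * q ^ k * norm (a n)) * q ^ (n - k)"
      by (simp add: mult_ac)
    then have "norm (a (n - k)) \<le> C * q ^ k * norm (a n)"
      using q by (simp add: mult_le_cancel_right)
    then show "norm (a (n - k) / a n) \<le> C * q ^ k"
      using nz[of n] by (simp add: norm_divide divide_simps)
  qed
qed

lemma convolution_ratio_tendsto:
  fixes a h :: "nat \<Rightarrow> complex"
  assumes nz: "\<And>n. a n \<noteq> 0" and lim: "(\<lambda>n. a n / a (Suc n)) \<longlonglongrightarrow> 1"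
    and q: "q > 1" and h: "summable (\<lambda>n. norm (h n) * q ^ n)"
  shows "(\<lambda>n. (\<Sum>k\<le>n. h k * a (n - k)) / a n) \<longlonglongrightarrow> suminf h"
proof -
  obtain C N where C: "\<And>n k. n \<ge> N \<Longrightarrow> k \<le> n \<Longrightarrow> norm (a (n - k) / a n) \<le> C * q ^ k"
    using ratio_geometric_bound[OF nz lim q] by metis
  have C0: "C \<ge> 0" using C[of N 0] nz[of N] by simp
  define f where "f = (\<lambda>k n. if k \<le> n then h k * (a (n - k) / a n) else 0)"
  have "((\<lambda>n. \<Sum>k. f k n) \<longlongrightarrow> suminf h) sequentially"
  proof (rule conjunct2[OF conjunct2[OF tannerys_theorem]])
    fix k
    have "(\<lambda>n. h k * (a (n - k) / a n)) \<longlonglongrightarrow> h k * 1"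
      by (intro tendsto_mult tendsto_const tendsto_ratio_shift nz lim)
    then have "(\<lambda>n. h k * (a (n - k) / a n)) \<longlonglongrightarrow> h k" by simp
    moreover have "\<forall>\<^sub>F n in sequentially. h k * (a (n - k) / a n) = f k n"
      using eventually_ge_at_top[of k] by eventually_elim (simp add: f_def)
    ultimately show "(\<lambda>n. f k n) \<longlonglongrightarrow> h k"
      by (rule Lim_transform_eventually)
  next
    have "norm (f k n) \<le> C * (norm (h k) * q ^ k)" if "n \<ge> N" for k n
    proof (cases "k \<le> n")
      case True
      have "norm (h k) * norm (a (n - k) / a n) \<le> norm (h k) * (C * q ^ k)"
        by (intro mult_left_mono C that True) auto
      moreover have "norm (f k n) = norm (h k) * norm (a (n - k) / a n)"
        unfolding norm_mult[symmetric] using True by (simp add: f_def)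
      ultimately show ?thesis by (simp only: mult.left_commute)
    qed (use C0 q in \<open>simp add: f_def\<close>)
    then show "\<forall>\<^sub>F (k, n) in sequentially \<times>\<^sub>F sequentially. norm (f k n) \<le> C * (norm (h k) * q ^ k)"
      unfolding eventually_prod_sequentially by auto
  qed (use h in \<open>auto intro: summable_mult\<close>)
  moreover have "(\<Sum>k. f k n) = (\<Sum>k\<le>n. h k * a (n - k)) / a n" for n
  proof -
    have "(\<Sum>k. f k n) = (\<Sum>k\<le>n. f k n)"
      by (rule suminf_finite) (auto simp: f_def)
    then show ?thesis by (simp add: f_def sum_divide_distrib)
  qed
  ultimately show ?thesis by simp
qed

lemma convolution_finite_support_tendsto_0:
  fixes a h :: "nat \<Rightarrow> complex"
  assumes a: "\<And>n. n > N \<Longrightarrow> a n = 0" and h: "h \<longlonglongrightarrow> 0"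
  shows "(\<lambda>n. \<Sum>k\<le>n. a k * h (n - k)) \<longlonglongrightarrow> 0"
proof -
  have "(\<lambda>n. \<Sum>k\<le>N. a k * h (n - k)) \<longlonglongrightarrow> (\<Sum>k\<le>N. a k * 0)"
  proof (intro tendsto_sum tendsto_mult tendsto_const)
    fix k
    have "(\<lambda>n. h (n + k - k)) \<longlonglongrightarrow> 0" using h by simp
    then show "(\<lambda>n. h (n - k)) \<longlonglongrightarrow> 0" by (rule LIMSEQ_offset)
  qed
  then have "(\<lambda>n. \<Sum>k\<le>N. a k * h (n - k)) \<longlonglongrightarrow> 0" by simp
  then show ?thesis
  proof (rule Lim_transform_eventually)
    show "\<forall>\<^sub>F n in sequentially. (\<Sum>k\<le>N. a k * h (n - k)) = (\<Sum>k\<le>n. a k * h (n - k))"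
      using eventually_ge_at_top[of N]
    proof eventually_elim
      case (elim n)
      then show ?case by (intro sum.mono_neutral_left) (auto simp: a)
    qed
  qed
qed

lemma gbinomial_uminus_nonzero:
  fixes \<beta> :: complex
  assumes "\<beta> \<notin> \<int>\<^sub>\<le>\<^sub>0"
  shows "(- \<beta> gchoose n) \<noteq> 0"
proof -
  have "pochhammer \<beta> n \<noteq> 0" using assms by (auto simp: pochhammer_eq_0_iff)
  then show ?thesis by (simp add: gbinomial_pochhammer)
qed

lemma gbinomial_uminus_eq_0:
  fixes \<beta> :: complex
  assumes "\<beta> \<in> \<int>\<^sub>\<le>\<^sub>0"
  obtains N where "\<And>n. n > N \<Longrightarrow> (- \<beta> gchoose n) = 0"
proof -
  obtain N where N: "\<beta> = - of_nat N" using assms by (rule nonpos_Ints_cases')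
  have "(- \<beta> gchoose n) = 0" if "n > N" for n
    unfolding N using that by (simp flip: binomial_gbinomial)
  then show ?thesis using that by blast
qed

lemma gbinomial_uminus_ratio:
  fixes \<beta> :: complex
  assumes "\<beta> \<notin> \<int>\<^sub>\<le>\<^sub>0"
  defines "a \<equiv> \<lambda>n. (- \<beta> gchoose n) * (- 1) ^ n"
  shows "(\<lambda>n. a n / a (Suc n)) \<longlonglongrightarrow> 1"
proof -
  have "(\<lambda>n. (of_nat (Suc n) :: complex) / (\<beta> + of_nat n)) \<longlonglongrightarrow> 1"
  proof -
    have "(\<lambda>n. (1 + inverse (of_nat n)) / (\<beta> * inverse (of_nat n) + 1)) \<longlonglongrightarrow> (1 + 0) / (\<beta> * 0 + 1)"
      by (intro tendsto_intros lim_inverse_n) auto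
    then have "(\<lambda>n. (1 + inverse (of_nat n)) / (\<beta> * inverse (of_nat n) + 1)) \<longlonglongrightarrow> 1" by simp
    moreover have "\<forall>\<^sub>F n in sequentially.
        (1 + inverse (of_nat n)) / (\<beta> * inverse (of_nat n) + 1) = of_nat (Suc n) / (\<beta> + of_nat n)"
      using eventually_gt_at_top[of 0]
    proof eventually_elim
      case (elim n)
      have "(1 + inverse (of_nat n)) / (\<beta> * inverse (of_nat n) + 1) =
          (of_nat n * (1 + inverse (of_nat n))) / (of_nat n * (\<beta> * inverse (of_nat n) + 1))"
        using elim by (subst mult_divide_mult_cancel_left) auto
      also have "\<dots> = of_nat (Suc n) / (\<beta> + of_nat n)"
        using elim by (simp add: distrib_left add.commute)
      finally show ?case .
    qed
    ultimately show ?thesis by (rule Lim_transform_eventually)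
  qed
  moreover have "a n / a (Suc n) = of_nat (Suc n) / (\<beta> + of_nat n)" for n
  proof -
    have "of_nat (Suc n) * (- \<beta> gchoose Suc n) = - ((\<beta> + of_nat n) * (- \<beta> gchoose n))"
      by (simp only: gbinomial_Suc_mult) (simp add: algebra_simps)
    then have "of_nat (Suc n) * (- \<beta> gchoose Suc n) * (- 1) ^ Suc n =
        - ((\<beta> + of_nat n) * (- \<beta> gchoose n)) * (- 1) ^ Suc n" by (rule arg_cong)
    then have "of_nat (Suc n) * a (Suc n) = (\<beta> + of_nat n) * a n"
      by (simp add: a_def mult.assoc)
    moreover have "a (Suc n) \<noteq> 0" using gbinomial_uminus_nonzero[OF assms(1)] by (simp add: a_def)
    moreover have "\<beta> + of_nat n \<noteq> 0"
    proof
      assume "\<beta> + of_nat n = 0"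
      then have "\<beta> = - of_nat n" by (rule eq_neg_iff_add_eq_0[THEN iffD2])
      then show False using assms(1) by simp
    qed
    ultimately show ?thesis by (simp add: frac_eq_eq mult_ac)
  qed
  ultimately show ?thesis by simp
qed

text \<open>A reformulation of Euler's limit for the Gamma function.\<close>

lemma gbinomial_uminus_asymp_equiv:
  fixes \<beta> :: complex
  assumes "\<beta> \<notin> \<int>\<^sub>\<le>\<^sub>0"
  shows "(\<lambda>n. (- \<beta> gchoose n) * (- 1) ^ n) \<sim>[at_top] (\<lambda>n. of_nat n powr (\<beta> - 1) / Gamma \<beta>)"
proof -
  have G: "Gamma \<beta> \<noteq> 0" using assms by (simp add: Gamma_eq_zero_iff)
  have "(\<lambda>n. (- \<beta> gchoose n) / ((- 1) ^ n / exp ((- \<beta> + 1) * of_real (ln (real n))))) \<longlonglongrightarrow>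
      inverse (Gamma \<beta>)"
    using gbinomial_asymptotic[of "- \<beta>"] by simp
  then have "(\<lambda>n. (- \<beta> gchoose n) / ((- 1) ^ n / exp ((- \<beta> + 1) * of_real (ln (real n)))) * Gamma \<beta>)
      \<longlonglongrightarrow> inverse (Gamma \<beta>) * Gamma \<beta>" by (intro tendsto_intros)
  then have "(\<lambda>n. (- \<beta> gchoose n) / ((- 1) ^ n / exp ((- \<beta> + 1) * of_real (ln (real n)))) * Gamma \<beta>)
      \<longlonglongrightarrow> 1" using G by simp
  then show ?thesis
  proof (rule asymp_equivI'[OF Lim_transform_eventually])
    show "\<forall>\<^sub>F n in sequentially.
        (- \<beta> gchoose n) / ((- 1) ^ n / exp ((- \<beta> + 1) * of_real (ln (real n)))) * Gamma \<beta> =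
        (- \<beta> gchoose n) * (- 1) ^ n / (of_nat n powr (\<beta> - 1) / Gamma \<beta>)"
      using eventually_gt_at_top[of 0]
    proof eventually_elim
      case (elim n)
      have "(of_nat n :: complex) powr (\<beta> - 1) = exp ((\<beta> - 1) * of_real (ln (real n)))"
        using elim by (simp add: powr_def flip: Ln_of_nat)
      also have "\<dots> = inverse (exp ((- \<beta> + 1) * of_real (ln (real n))))"
        by (simp add: algebra_simps flip: exp_minus)
      finally have p: "(of_nat n :: complex) powr (\<beta> - 1) = inverse (exp ((- \<beta> + 1) * of_real (ln (real n))))" .
      have "(- 1) ^ n = (1::complex) \<or> (- 1) ^ n = (-1::complex)"
        by (metis minus_one_power_iff)
      then show ?case unfolding p by (auto simp: field_simps)
    qed
  qed
qed

text \<open>The other factors converge beyond the unit disc, so the growth of the coefficients is that of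
  the last factor, whose only singularity is \<open>z = 1\<close>; it has none when \<open>\<beta>0\<close> is a nonpositive
  integer.\<close>

lemma prod_binom_fps_asymp:
  fixes r \<beta> :: "'j \<Rightarrow> complex" and \<beta>0 :: complex
  assumes J: "finite J" and r: "\<And>j. j \<in> J \<Longrightarrow> norm (r j) < 1"
  defines "F \<equiv> (\<Prod>j\<in>J. binom_fps (r j) (\<beta> j)) * binom_fps 1 \<beta>0"
  shows "\<beta>0 \<notin> \<int>\<^sub>\<le>\<^sub>0 \<Longrightarrow> (\<lambda>n. F $ n) \<sim>[at_top]
      (\<lambda>n. of_nat n powr (\<beta>0 - 1) / Gamma \<beta>0 * (\<Prod>j\<in>J. (1 - r j) powr (- \<beta> j)))"
    and "\<beta>0 \<in> \<int>\<^sub>\<le>\<^sub>0 \<Longrightarrow> (\<lambda>n. F $ n) \<longlonglongrightarrow> 0"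
proof -
  define H where "H = (\<Prod>j\<in>J. binom_fps (r j) (\<beta> j))"
  define S where "S = (\<Prod>j\<in>J. (1 - r j) powr (- \<beta> j))"
  define a where "a = (\<lambda>n. (- \<beta>0 gchoose n) * (- 1) ^ n)"
  define \<rho> where "\<rho> = Max (insert 0 ((\<lambda>j. norm (r j)) ` J))"
  define q where "q = 2 / (1 + \<rho>)"
  \<comment> \<open>The factors other than the last one converge absolutely at \<open>q > 1\<close>.\<close>
  have \<rho>: "0 \<le> \<rho>" "\<rho> < 1" and r_le: "\<And>j. j \<in> J \<Longrightarrow> norm (r j) \<le> \<rho>"
    using J r by (auto simp: \<rho>_def)
  have q: "q > 1" "\<rho> * q < 1" using \<rho> by (auto simp: q_def divide_simps)
  have rq: "norm (r j * of_real q) < 1" if "j \<in> J" for j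
  proof -
    have "norm (r j) * q \<le> \<rho> * q" using r_le[OF that] q by (intro mult_right_mono) auto
    also have "\<dots> < 1" by (rule q(2))
    finally show ?thesis using q by (simp add: norm_mult)
  qed
  have H_q: "summable (\<lambda>n. norm (H $ n) * q ^ n)"
    using prod_binom_fps_sums(1)[OF J rq, where \<beta> = \<beta>] q
    by (simp add: H_def norm_mult norm_power)
  have H_sums: "(\<lambda>n. H $ n) sums S"
    using prod_binom_fps_sums(2)[OF J, where r = r and z = 1 and \<beta> = \<beta>] r by (simp add: H_def S_def)
  have S: "S \<noteq> 0"
  proof -
    have "1 - r j \<noteq> 0" if "j \<in> J" for j using r[OF that] by auto
    then show ?thesis using J by (simp add: S_def)
  qed
  have F_eq: "F $ n = (\<Sum>k\<le>n. H $ k * a (n - k))" and F_eq': "F $ n = (\<Sum>k\<le>n. a k * H $ (n - k))" for n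
  proof -
    have [simp]: "binom_fps 1 \<beta>0 $ k = a k" for k by (simp add: binom_fps_def a_def)
    have F: "F = H * binom_fps 1 \<beta>0" "F = binom_fps 1 \<beta>0 * H" by (simp_all add: F_def H_def mult.commute)
    show "F $ n = (\<Sum>k\<le>n. H $ k * a (n - k))" unfolding F(1) by (simp add: fps_mult_nth atLeast0AtMost)
    show "F $ n = (\<Sum>k\<le>n. a k * H $ (n - k))" unfolding F(2) by (simp add: fps_mult_nth atLeast0AtMost)
  qed
  show "(\<lambda>n. F $ n) \<sim>[at_top] (\<lambda>n. of_nat n powr (\<beta>0 - 1) / Gamma \<beta>0 *
      (\<Prod>j\<in>J. (1 - r j) powr (- \<beta> j)))" if \<beta>0: "\<beta>0 \<notin> \<int>\<^sub>\<le>\<^sub>0"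
  proof -
    have nz: "a n \<noteq> 0" for n using gbinomial_uminus_nonzero[OF \<beta>0] by (simp add: a_def)
    have "(\<lambda>n. F $ n / a n) \<longlonglongrightarrow> S"
      unfolding F_eq sums_unique[OF H_sums]
      by (rule convolution_ratio_tendsto[OF nz _ q(1) H_q])
        (use gbinomial_uminus_ratio[OF \<beta>0] in \<open>simp add: a_def\<close>)
    then have "(\<lambda>n. F $ n / a n / S) \<longlonglongrightarrow> S / S" using S by (intro tendsto_divide tendsto_const)
    then have "(\<lambda>n. F $ n) \<sim>[at_top] (\<lambda>n. a n * S)"
      using S by (intro asymp_equivI') simp
    also have "(\<lambda>n. a n * S) \<sim>[at_top] (\<lambda>n. of_nat n powr (\<beta>0 - 1) / Gamma \<beta>0 * S)"
      unfolding a_def by (intro asymp_equiv_mult gbinomial_uminus_asymp_equiv \<beta>0 asymp_equiv_refl)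
    finally show ?thesis unfolding S_def .
  qed
  show "(\<lambda>n. F $ n) \<longlonglongrightarrow> 0" if \<beta>0: "\<beta>0 \<in> \<int>\<^sub>\<le>\<^sub>0"
  proof -
    obtain N where "\<And>n. n > N \<Longrightarrow> a n = 0"
      using gbinomial_uminus_eq_0[OF \<beta>0] unfolding a_def by (metis mult_zero_left)
    then show ?thesis unfolding F_eq'
      using summable_LIMSEQ_zero[OF sums_summable[OF H_sums]]
      by (rule convolution_finite_support_tendsto_0)
  qed
qed

text \<open>The mean of the cycle weight for a power-sum sequence \<open>c\<close> with exactly one base,
  \<open>r i = 1\<close>, on the unit circle and the other bases inside.\<close>

lemma cycle_weight_mean_asymp:
  fixes r \<beta> :: "'j \<Rightarrow> complex" and c :: "nat \<Rightarrow> complex"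
  assumes K: "finite K" "i \<in> K" and r_i: "r i = 1"
    and r: "\<And>j. j \<in> K - {i} \<Longrightarrow> norm (r j) < 1"
    and c: "\<And>l. c l = (\<Sum>j\<in>K. \<beta> j * r j ^ l)"
  defines "E \<equiv> \<lambda>n. (\<Sum>g | g permutes {1..n::nat}. cycle_weight c {1..n} g) / fact n"
  shows "\<beta> i \<notin> \<int>\<^sub>\<le>\<^sub>0 \<Longrightarrow> E \<sim>[at_top]
      (\<lambda>n. of_nat n powr (\<beta> i - 1) / Gamma (\<beta> i) * (\<Prod>j\<in>K - {i}. (1 - r j) powr (- \<beta> j)))"
    and "\<beta> i \<in> \<int>\<^sub>\<le>\<^sub>0 \<Longrightarrow> E \<longlonglongrightarrow> 0"
proof -
  define F where "F = (\<Prod>j\<in>K. binom_fps (r j) (\<beta> j))"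
  have F_eq: "F = (\<Prod>j\<in>K - {i}. binom_fps (r j) (\<beta> j)) * binom_fps 1 (\<beta> i)"
    unfolding F_def using prod.remove[OF K, of "\<lambda>j. binom_fps (r j) (\<beta> j)"] r_i
    by (simp add: mult.commute)
  have E_eq: "E = (\<lambda>n. F $ n)"
  proof
    fix n :: nat
    have "(\<Sum>g | g permutes {1..n}. cycle_weight c {1..n} g) = fact (card {1..n}) * F $ card {1..n}"
      unfolding F_def using prod_binom_fps_recurrence[OF K(1), where r = r and \<beta> = \<beta>]
      by (intro sum_cycle_weight) (simp_all only: c finite_atLeastAtMost)
    then show "E n = F $ n" by (simp add: E_def)
  qed
  note asymp = prod_binom_fps_asymp[of "K - {i}" r "\<beta> i" \<beta>, folded F_eq E_eq]
  show "E \<sim>[at_top] (\<lambda>n. of_nat n powr (\<beta> i - 1) / Gamma (\<beta> i) *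
      (\<Prod>j\<in>K - {i}. (1 - r j) powr (- \<beta> j)))" if "\<beta> i \<notin> \<int>\<^sub>\<le>\<^sub>0"
    by (rule asymp(1)) (use K(1) r that in auto)
  show "E \<longlonglongrightarrow> 0" if "\<beta> i \<in> \<int>\<^sub>\<le>\<^sub>0"
    by (rule asymp(2)) (use K(1) r that in auto)
qed

unbundle no fps_syntax
unbundle vec_syntax

section \<open>Expectations as means of cycle weights\<close>

lemma mset_cycle_type:
  "mset (cycle_type n g) = image_mset card (mset_set (orbit g ` {1..n}))"
  by (simp add: cycle_type_def)

lemma prod_cycle_type:
  "(\<Prod>m<length (cycle_type n g). c (cycle_type n g ! m)) = cycle_weight c {1..n} g"
proof -
  let ?ls = "cycle_type n g"
  have "(\<Prod>m<length ?ls. c (?ls ! m)) = prod_list (map c ?ls)"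
    by (simp add: prod.list_conv_set_nth atLeast0LessThan)
  also have "\<dots> = prod_mset (image_mset c (mset ?ls))"
    by (simp add: prod_mset_prod_list flip: mset_map)
  also have "\<dots> = (\<Prod>A\<in>orbit g ` {1..n}. c (card A))"
    unfolding mset_cycle_type by (simp add: image_mset.compositionality o_def prod_unfold_prod_mset)
  finally show ?thesis by (simp add: cycle_weight_def)
qed

lemma length_cycle_type_le: "length (cycle_type n g) \<le> n"
proof -
  have "length (cycle_type n g) = card (orbit g ` {1..n})"
    using arg_cong[OF mset_cycle_type, of size n g] by simp
  also have "\<dots> \<le> n" using card_image_le[of "{1..n}" "orbit g"] by simp
  finally show ?thesis .
qed

lemma nth_cycle_type_le:
  assumes "g permutes {1..n}" "m < length (cycle_type n g)"
  shows "cycle_type n g ! m \<le> n"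
proof -
  have "cycle_type n g ! m \<in># mset (cycle_type n g)" using assms(2) by simp
  then obtain y where y: "y \<in> {1..n}" "cycle_type n g ! m = card (orbit g y)"
    unfolding mset_cycle_type by auto
  have "card (orbit g y) \<le> card {1..n}"
    using permutes_orbit_subset[OF assms(1) y(1)] by (intro card_mono) auto
  then show ?thesis using y by simp
qed

text \<open>Fubini for a finite uniform first factor; the integrability on the product space follows from
  that of the finitely many sections.\<close>

lemma integral_uniform_count_pair:
  fixes f :: "'b \<Rightarrow> 'c \<Rightarrow> complex"
  assumes A: "finite A" "A \<noteq> {}" and N: "prob_space N"
    and f: "\<And>g. g \<in> A \<Longrightarrow> integrable N (f g)"
  shows "(\<integral>(g, t). f g t \<partial>(uniform_count_measure A \<Otimes>\<^sub>M N)) =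
    (\<Sum>g\<in>A. \<integral>t. f g t \<partial>N) / of_nat (card A)"
proof -
  let ?U = "uniform_count_measure A"
  interpret N: prob_space N by fact
  interpret U: prob_space ?U using A by (rule prob_space_uniform_count_measure)
  interpret P: pair_sigma_finite ?U N ..
  have U_int: "integrable ?U h" for h :: "'b \<Rightarrow> real"
    unfolding uniform_count_measure_def using A(1) by (rule integrable_point_measure_finite)
  have "integrable (?U \<Otimes>\<^sub>M N) (\<lambda>(g, t). f g t)"
  proof (rule P.Fubini_integrable)
    have "(\<lambda>(g, t). f g t) \<in> borel_measurable (count_space A \<Otimes>\<^sub>M N)"
      using A(1) f by (intro measurable_pair_measure_countable1) (auto intro: countable_finite)
    also have "borel_measurable (count_space A \<Otimes>\<^sub>M N) = borel_measurable (?U \<Otimes>\<^sub>M N)"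
      by (intro measurable_cong_sets sets_pair_measure_cong refl)
        (simp_all add: sets_uniform_count_measure)
    finally show "(\<lambda>(g, t). f g t) \<in> borel_measurable (?U \<Otimes>\<^sub>M N)" .
    show "AE g in ?U. integrable N (\<lambda>t. case (g, t) of (g, t) \<Rightarrow> f g t)"
      using f by (intro AE_I2) (simp add: space_uniform_count_measure)
  qed (rule U_int)
  then have "(\<integral>(g, t). f g t \<partial>(?U \<Otimes>\<^sub>M N)) = (\<integral>g. (\<integral>t. f g t \<partial>N) \<partial>?U)"
    by (rule P.integral_fst[symmetric])
  also have "\<dots> = (\<Sum>g\<in>A. (1 / real (card A)) *\<^sub>R (\<integral>t. f g t \<partial>N))"
    unfolding uniform_count_measure_def using A(1)
    by (intro lebesgue_integral_point_measure_finite) auto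
  also have "\<dots> = (\<Sum>g\<in>A. \<integral>t. f g t \<partial>N) / of_nat (card A)"
    by (simp add: scaleR_conv_of_real sum_divide_distrib)
  finally show ?thesis .
qed

text \<open>Independence: the expectation of a product over some of the coordinates factors.\<close>

lemma integral_PiM_prod_subset:
  fixes f :: "'i \<Rightarrow> 'b \<Rightarrow> complex"
  assumes "prob_space L" and I: "finite I" "J \<subseteq> I" and f: "\<And>i. i \<in> J \<Longrightarrow> integrable L (f i)"
  shows "integrable (\<Pi>\<^sub>M i\<in>I. L) (\<lambda>t. \<Prod>i\<in>J. f i (t i))"
    and "(\<integral>t. (\<Prod>i\<in>J. f i (t i)) \<partial>(\<Pi>\<^sub>M i\<in>I. L)) = (\<Prod>i\<in>J. \<integral>y. f i y \<partial>L)"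
proof -
  interpret L: prob_space L by fact
  interpret P: product_sigma_finite "\<lambda>_. L" ..
  define F where "F = (\<lambda>i. if i \<in> J then f i else (\<lambda>_. 1))"
  have F: "integrable L (F i)" for i using f by (simp add: F_def)
  have eq: "(\<lambda>t. \<Prod>i\<in>J. f i (t i)) = (\<lambda>t. \<Prod>i\<in>I. F i (t i))"
    using I by (intro ext prod.mono_neutral_cong_left) (auto simp: F_def)
  show "integrable (\<Pi>\<^sub>M i\<in>I. L) (\<lambda>t. \<Prod>i\<in>J. f i (t i))"
    unfolding eq using I F by (intro P.product_integrable_prod)
  have "(\<integral>t. (\<Prod>i\<in>J. f i (t i)) \<partial>(\<Pi>\<^sub>M i\<in>I. L)) = (\<Prod>i\<in>I. \<integral>y. F i y \<partial>L)"
    unfolding eq using I F by (intro P.product_integral_prod)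
  also have "\<dots> = (\<Prod>i\<in>J. \<integral>y. f i y \<partial>L)"
    using I by (intro prod.mono_neutral_cong_right) (auto simp: F_def L.prob_space)
  finally show "(\<integral>t. (\<Prod>i\<in>J. f i (t i)) \<partial>(\<Pi>\<^sub>M i\<in>I. L)) = (\<Prod>i\<in>J. \<integral>y. f i y \<partial>L)" .
qed

text \<open>A pair of random variables on the unit circle, defined on one probability space.\<close>

locale unimodular_pair = prob_space M for M :: "'a measure" +
  fixes \<theta> \<eta> :: "'a \<Rightarrow> complex"
  assumes \<theta>_measurable [measurable]: "\<theta> \<in> borel_measurable M"
    and \<eta>_measurable [measurable]: "\<eta> \<in> borel_measurable M"
    and norm_\<theta>: "\<And>\<omega>. \<omega> \<in> space M \<Longrightarrow> norm (\<theta> \<omega>) = 1"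
    and norm_\<eta>: "\<And>\<omega>. \<omega> \<in> space M \<Longrightarrow> norm (\<eta> \<omega>) = 1"
begin

abbreviation law :: "(complex \<times> complex) measure" where
  "law \<equiv> joint_law M \<theta> \<eta>"

abbreviation moment :: "nat \<Rightarrow> nat \<Rightarrow> complex" where
  "moment \<equiv> joint_moment M \<theta> \<eta>"

lemma pair_measurable [measurable]: "(\<lambda>\<omega>. (\<theta> \<omega>, \<eta> \<omega>)) \<in> borel_measurable M"
  by (simp flip: borel_prod)

lemma prob_space_law: "prob_space law"
  unfolding joint_law_def by (rule prob_space_distr) measurable

lemma integrable_monomial: "integrable M (\<lambda>\<omega>. \<theta> \<omega> ^ k1 * \<eta> \<omega> ^ k2)"
  by (rule integrable_const_bound[where B = 1])
    (auto simp: norm_mult norm_power norm_\<theta> norm_\<eta>)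

lemma moment_0 [simp]: "moment 0 0 = 1"
  by (simp add: joint_moment_def prob_space)

lemma norm_moment_le_1: "norm (moment k1 k2) \<le> 1"
proof -
  have "norm (moment k1 k2) \<le> (\<integral>\<omega>. norm (\<theta> \<omega> ^ k1 * \<eta> \<omega> ^ k2) \<partial>M)"
    unfolding joint_moment_def by (rule integral_norm_bound)
  also have "\<dots> = (\<integral>\<omega>. 1 \<partial>M)"
    by (intro Bochner_Integration.integral_cong) (auto simp: norm_mult norm_power norm_\<theta> norm_\<eta>)
  finally show ?thesis by (simp add: prob_space)
qed

lemma law_monomial:
  "integrable law (\<lambda>y. fst y ^ k1 * snd y ^ k2)"
  "(\<integral>y. fst y ^ k1 * snd y ^ k2 \<partial>law) = moment k1 k2"
proof -
  have [measurable]: "(\<lambda>y::complex \<times> complex. fst y ^ k1 * snd y ^ k2) \<in> borel_measurable borel"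
    by (intro borel_measurable_continuous_onI continuous_intros)
  show "integrable law (\<lambda>y. fst y ^ k1 * snd y ^ k2)"
    unfolding joint_law_def using integrable_monomial[of k1 k2] by (subst integrable_distr_eq) auto
  show "(\<integral>y. fst y ^ k1 * snd y ^ k2 \<partial>law) = moment k1 k2"
    unfolding joint_law_def joint_moment_def by (subst integral_distr) auto
qed

lemma expectation_rand_space:
  fixes c :: "nat \<Rightarrow> complex"
  assumes "\<And>g. g permutes {1..n} \<Longrightarrow> integrable (\<Pi>\<^sub>M i\<in>I. law) (f g)"
    and "\<And>g. g permutes {1..n} \<Longrightarrow> (\<integral>t. f g t \<partial>(\<Pi>\<^sub>M i\<in>I. law)) = cycle_weight c {1..n} g"
  shows "(\<integral>(g, t). f g t \<partial>rand_space n I M \<theta> \<eta>) =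
    (\<Sum>g | g permutes {1..n}. cycle_weight c {1..n} g) / fact n"
proof -
  interpret P: prob_space "\<Pi>\<^sub>M i\<in>I. law" by (intro prob_space_PiM prob_space_law)
  have "sym_perms n \<noteq> {}" using permutes_id[of "{1..n}"] unfolding sym_perms_def by blast
  then have "(\<integral>(g, t). f g t \<partial>rand_space n I M \<theta> \<eta>) =
      (\<Sum>g\<in>sym_perms n. \<integral>t. f g t \<partial>(\<Pi>\<^sub>M i\<in>I. law)) / of_nat (card (sym_perms n))"
    unfolding rand_space_def
    by (intro integral_uniform_count_pair P.prob_space_axioms)
      (use assms(1) in \<open>auto simp: sym_perms_def finite_permutations\<close>)
  then show ?thesis
    using assms(2) by (simp add: sym_perms_def card_permutations)
qed

lemma E1_eq:
  fixes x1 x2 :: complex and b :: "nat \<Rightarrow> nat \<Rightarrow> complex"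
  defines "c \<equiv> \<lambda>l. \<Sum>(k1, k2)\<in>coeff_supp b. b k1 k2 * moment k1 k2 * (x1 ^ k1 * x2 ^ k2) ^ l"
  shows "E1 M \<theta> \<eta> b x1 x2 n = (\<Sum>g | g permutes {1..n}. cycle_weight c {1..n} g) / fact n"
  unfolding E1_def
proof (rule expectation_rand_space)
  fix g assume "g permutes {1..n}"
  let ?ls = "cycle_type n g"
  \<comment> \<open>\<open>f m y\<close> is the factor of the cycle with index \<open>m\<close> when its pair is \<open>y\<close>.\<close>
  define f where "f = (\<lambda>m y. poly2 b (fst y * x1 ^ (?ls ! m)) (snd y * x2 ^ (?ls ! m)))"
  have f_eq: "f m = (\<lambda>y. \<Sum>(k1, k2)\<in>coeff_supp b.
      b k1 k2 * (x1 ^ k1 * x2 ^ k2) ^ (?ls ! m) * (fst y ^ k1 * snd y ^ k2))" for m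
    unfolding f_def poly2_def
    by (intro ext sum.cong refl) (auto simp: power_mult_distrib mult_ac power_commutes simp flip: power_mult)
  have f_int: "integrable law (f m)" for m
    unfolding f_eq by (auto intro!: Bochner_Integration.integrable_sum law_monomial simp: case_prod_beta)
  have f_val: "(\<integral>y. f m y \<partial>law) = c (?ls ! m)" for m
  proof -
    have "(\<integral>y. f m y \<partial>law) = (\<Sum>k\<in>coeff_supp b.
        b (fst k) (snd k) * (x1 ^ fst k * x2 ^ snd k) ^ (?ls ! m) * moment (fst k) (snd k))"
      unfolding f_eq case_prod_beta
      by (subst Bochner_Integration.integral_sum) (simp_all add: law_monomial)
    then show ?thesis by (simp add: c_def case_prod_beta mult_ac)
  qed
  have W: "W1 b x1 x2 n g = (\<lambda>t. \<Prod>m<length ?ls. f m (t m))"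
    by (simp add: W1_def f_def Let_def fun_eq_iff)
  have sub: "{..<length ?ls} \<subseteq> {..<n}" using length_cycle_type_le[of n g] by auto
  show "integrable (\<Pi>\<^sub>M i\<in>{..<n}. law) (W1 b x1 x2 n g)"
    unfolding W by (rule integral_PiM_prod_subset[OF prob_space_law _ sub f_int]) simp
  have "(\<integral>t. W1 b x1 x2 n g t \<partial>(\<Pi>\<^sub>M i\<in>{..<n}. law)) = (\<Prod>m<length ?ls. c (?ls ! m))"
    unfolding W f_val[symmetric]
    by (rule integral_PiM_prod_subset[OF prob_space_law _ sub f_int]) simp
  then show "(\<integral>t. W1 b x1 x2 n g t \<partial>(\<Pi>\<^sub>M i\<in>{..<n}. law)) = cycle_weight c {1..n} g"
    by (simp add: prod_cycle_type)
qed

text \<open>In the second model a factor of the product involves all the pairs on its cycle. Expanding the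
  product over the cycles into a sum over choices \<open>\<kappa>\<close> of one monomial per cycle yields products
  of functions of single pairs.\<close>

lemma E2_eq:
  fixes x1 x2 :: complex
  assumes fin: "finite (coeff_supp b)"
  defines "c \<equiv> \<lambda>l. \<Sum>(k1, k2)\<in>coeff_supp b. b k1 k2 * (moment k1 k2 * x1 ^ k1 * x2 ^ k2) ^ l"
  shows "E2 M \<theta> \<eta> b x1 x2 n = (\<Sum>g | g permutes {1..n}. cycle_weight c {1..n} g) / fact n"
  unfolding E2_def
proof (rule expectation_rand_space)
  fix g assume g: "g permutes {1..n}"
  let ?ls = "cycle_type n g" and ?K = "coeff_supp b" and ?I = "{..<n} \<times> {..<n}"
  \<comment> \<open>For the cycle with index \<open>m\<close> and a monomial \<open>k\<close>, \<open>B m k\<close> is the deterministic part and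
    \<open>q k y\<close> the contribution of a point with pair \<open>y\<close>. The points that belong to some cycle are
    the index pairs in \<open>J\<close>.\<close>
  define B where "B = (\<lambda>m (k::nat\<times>nat). b (fst k) (snd k) * (x1 ^ fst k * x2 ^ snd k) ^ (?ls ! m))"
  define q where "q = (\<lambda>(k::nat\<times>nat) y. fst y ^ fst k * snd y ^ snd k :: complex)"
  define J where "J = Sigma {..<length ?ls} (\<lambda>m. {..<?ls ! m})"
  define R where "R = (\<lambda>\<kappa> t. \<Prod>j\<in>J. q (\<kappa> (fst j)) (t j))"
  have W: "W2 b x1 x2 n g = (\<lambda>t. \<Sum>\<kappa>\<in>PiE {..<length ?ls} (\<lambda>_. ?K).
      (\<Prod>m<length ?ls. B m (\<kappa> m)) * R \<kappa> t)"
  proof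
    fix t
    have "poly2 b (x1 ^ l * (\<Prod>i<l. fst (t (m, i)))) (x2 ^ l * (\<Prod>i<l. snd (t (m, i)))) =
        (\<Sum>k\<in>?K. b (fst k) (snd k) * (x1 ^ fst k * x2 ^ snd k) ^ l * (\<Prod>i<l. q k (t (m, i))))" for m l :: nat
      unfolding poly2_def q_def case_prod_beta
      by (intro sum.cong refl) (simp add: power_mult_distrib mult_ac prod.distrib prod_power_distrib flip: power_mult)
    then have "W2 b x1 x2 n g t =
        (\<Prod>m<length ?ls. \<Sum>k\<in>?K. B m k * (\<Prod>i<?ls ! m. q k (t (m, i))))"
      by (simp add: W2_def B_def Let_def)
    also have "\<dots> = (\<Sum>\<kappa>\<in>PiE {..<length ?ls} (\<lambda>_. ?K).
        \<Prod>m<length ?ls. B m (\<kappa> m) * (\<Prod>i<?ls ! m. q (\<kappa> m) (t (m, i))))"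
      using fin by (intro prod_sum_PiE) auto
    also have "\<dots> = (\<Sum>\<kappa>\<in>PiE {..<length ?ls} (\<lambda>_. ?K). (\<Prod>m<length ?ls. B m (\<kappa> m)) * R \<kappa> t)"
      unfolding R_def J_def by (simp add: prod.distrib prod.Sigma case_prod_beta)
    finally show "W2 b x1 x2 n g t = \<dots>" .
  qed
  have sub: "J \<subseteq> ?I"
    using length_cycle_type_le[of n g] nth_cycle_type_le[OF g] by (force simp: J_def)
  have q_int: "integrable law (q k)" and q_val: "(\<integral>y. q k y \<partial>law) = moment (fst k) (snd k)" for k
    unfolding q_def by (rule law_monomial)+
  have R_int: "integrable (\<Pi>\<^sub>M i\<in>?I. law) (R \<kappa>)" for \<kappa>
    unfolding R_def by (rule integral_PiM_prod_subset[OF prob_space_law _ sub q_int]) simp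
  have R_val: "(\<integral>t. R \<kappa> t \<partial>(\<Pi>\<^sub>M i\<in>?I. law)) =
      (\<Prod>m<length ?ls. moment (fst (\<kappa> m)) (snd (\<kappa> m)) ^ (?ls ! m))" for \<kappa>
  proof -
    have "(\<integral>t. R \<kappa> t \<partial>(\<Pi>\<^sub>M i\<in>?I. law)) = (\<Prod>j\<in>J. \<integral>y. q (\<kappa> (fst j)) y \<partial>law)"
      unfolding R_def by (rule integral_PiM_prod_subset[OF prob_space_law _ sub q_int]) simp
    also have "\<dots> = (\<Prod>m<length ?ls. \<Prod>i<?ls ! m. moment (fst (\<kappa> m)) (snd (\<kappa> m)))"
      unfolding J_def q_val by (simp add: prod.Sigma case_prod_beta del: prod_constant)
    finally show ?thesis by simp
  qed
  show "integrable (\<Pi>\<^sub>M i\<in>?I. law) (W2 b x1 x2 n g)"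
    unfolding W by (intro Bochner_Integration.integrable_sum integrable_mult_right R_int)
  have "(\<integral>t. W2 b x1 x2 n g t \<partial>(\<Pi>\<^sub>M i\<in>?I. law)) =
      (\<Sum>\<kappa>\<in>PiE {..<length ?ls} (\<lambda>_. ?K).
        \<Prod>m<length ?ls. B m (\<kappa> m) * moment (fst (\<kappa> m)) (snd (\<kappa> m)) ^ (?ls ! m))"
    unfolding W using R_int
    by (subst Bochner_Integration.integral_sum) (auto simp: R_val prod.distrib)
  also have "\<dots> = (\<Prod>m<length ?ls. \<Sum>k\<in>?K. B m k * moment (fst k) (snd k) ^ (?ls ! m))"
    using fin by (intro prod_sum_PiE[symmetric]) auto
  also have "\<dots> = (\<Prod>m<length ?ls. c (?ls ! m))"
    unfolding B_def c_def case_prod_beta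
    by (intro prod.cong sum.cong refl) (simp add: power_mult_distrib mult_ac)
  finally show "(\<integral>t. W2 b x1 x2 n g t \<partial>(\<Pi>\<^sub>M i\<in>?I. law)) = cycle_weight c {1..n} g"
    by (simp add: prod_cycle_type)
qed

end

section \<open>The asymptotics of the expectations\<close>

lemma norm_monomial_less_1:
  fixes x1 x2 :: complex
  assumes "norm x1 < 1" "norm x2 < 1" "k1 + k2 \<noteq> (0::nat)"
  shows "norm (x1 ^ k1 * x2 ^ k2) < 1"
proof (cases "k1 = 0")
  case True
  then show ?thesis using assms by (simp add: norm_power power_less_one_iff)
next
  case False
  have "norm x1 ^ k1 * norm x2 ^ k2 \<le> norm x1 ^ k1 * 1"
    using assms by (intro mult_left_mono power_le_one) auto
  also have "\<dots> < 1" using assms False by (simp add: power_less_one_iff)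
  finally show ?thesis by (simp add: norm_mult norm_power)
qed

theorem theorem4p7:
  fixes M :: "'a measure"
    and \<theta> \<eta> :: "'a \<Rightarrow> complex"
    and x1 x2 :: complex
    and b :: "nat \<Rightarrow> nat \<Rightarrow> complex"
  assumes "prob_space M"
    and "\<theta> \<in> borel_measurable M" and "\<eta> \<in> borel_measurable M"
    and "\<And>\<omega>. \<omega> \<in> space M \<Longrightarrow> norm (\<theta> \<omega>) = 1"
    and "\<And>\<omega>. \<omega> \<in> space M \<Longrightarrow> norm (\<eta> \<omega>) = 1"
    and "norm x1 < 1" and "norm x2 < 1"
    and "finite {(k1, k2). b k1 k2 \<noteq> 0}"
  shows "(b 0 0 \<notin> \<int>\<^sub>\<le>\<^sub>0 \<longrightarrow>
           (\<lambda>n. E1 M \<theta> \<eta> b x1 x2 n) \<sim>[at_top]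
             (\<lambda>n. of_nat n powr (b 0 0 - 1) / Gamma (b 0 0) *
               (\<Prod>(k1, k2)\<in>{(k1, k2). b k1 k2 \<noteq> 0 \<and> k1 + k2 \<noteq> 0}.
                  (1 - x1 ^ k1 * x2 ^ k2) powr (- b k1 k2 * joint_moment M \<theta> \<eta> k1 k2))) \<and>
           (\<lambda>n. E2 M \<theta> \<eta> b x1 x2 n) \<sim>[at_top]
             (\<lambda>n. of_nat n powr (b 0 0 - 1) / Gamma (b 0 0) *
               (\<Prod>(k1, k2)\<in>{(k1, k2). b k1 k2 \<noteq> 0 \<and> k1 + k2 \<noteq> 0}.
                  (1 - joint_moment M \<theta> \<eta> k1 k2 * x1 ^ k1 * x2 ^ k2) powr (- b k1 k2)))) \<and>
         (b 0 0 \<in> \<int>\<^sub>\<le>\<^sub>0 \<longrightarrow>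
           (\<lambda>n. E1 M \<theta> \<eta> b x1 x2 n) \<longlonglongrightarrow> 0 \<and>
           (\<lambda>n. E2 M \<theta> \<eta> b x1 x2 n) \<longlonglongrightarrow> 0)"
proof -
  interpret unimodular_pair M \<theta> \<eta>
    using assms by (intro unimodular_pair.intro unimodular_pair_axioms.intro)
  define J where "J = {(k1, k2). b k1 k2 \<noteq> 0 \<and> k1 + k2 \<noteq> 0}"
  let ?K = "insert (0, 0) J" and ?\<alpha> = "\<lambda>k. moment (fst k) (snd k)"
  let ?x = "\<lambda>k. x1 ^ fst k * x2 ^ snd k" and ?b = "\<lambda>k. b (fst k) (snd k)"
  have fin: "finite (coeff_supp b)" using assms(8) by (simp add: coeff_supp_def)
  have J: "finite J" "J = ?K - {(0, 0)}" and supp: "coeff_supp b \<subseteq> ?K"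
    by (auto simp: J_def coeff_supp_def intro: finite_subset[OF _ fin])
  \<comment> \<open>The index \<open>(0, 0)\<close> is included even when \<open>b 0 0 = 0\<close>, and then contributes nothing.\<close>
  have supp_sum: "(\<Sum>(k1, k2)\<in>coeff_supp b. b k1 k2 * f k1 k2) = (\<Sum>k\<in>?K. ?b k * f (fst k) (snd k))"
    for f :: "nat \<Rightarrow> nat \<Rightarrow> complex"
    unfolding case_prod_beta using J(1) supp
    by (intro sum.mono_neutral_left) (auto simp: coeff_supp_def)
  have x: "norm (?x k) < 1" if "k \<in> J" for k
    using norm_monomial_less_1[OF assms(6,7), of "fst k" "snd k"] that by (auto simp: J_def)
  have \<alpha>x: "norm (?\<alpha> k * ?x k) < 1" if "k \<in> J" for k
  proof -
    have "norm (?\<alpha> k) * norm (?x k) \<le> 1 * norm (?x k)"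
      by (intro mult_right_mono norm_moment_le_1) auto
    also have "\<dots> < 1" using x[OF that] by simp
    finally show ?thesis by (simp only: norm_mult)
  qed
  define c1 where "c1 = (\<lambda>l. \<Sum>(k1, k2)\<in>coeff_supp b. b k1 k2 * moment k1 k2 * (x1 ^ k1 * x2 ^ k2) ^ l)"
  define c2 where "c2 = (\<lambda>l. \<Sum>(k1, k2)\<in>coeff_supp b. b k1 k2 * (moment k1 k2 * x1 ^ k1 * x2 ^ k2) ^ l)"
  have c1: "c1 l = (\<Sum>k\<in>?K. ?b k * ?\<alpha> k * ?x k ^ l)" for l
    unfolding c1_def mult.assoc by (rule supp_sum)
  have c2: "c2 l = (\<Sum>k\<in>?K. ?b k * (?\<alpha> k * ?x k) ^ l)" for l
    unfolding c2_def mult.assoc by (rule supp_sum)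
  note E1 = cycle_weight_mean_asymp[where K = ?K and i = "(0, 0)" and r = ?x
      and \<beta> = "\<lambda>k. ?b k * ?\<alpha> k" and c = c1, folded E1_eq[where b = b and ?x1.0 = x1 and ?x2.0 = x2, folded c1_def]]
  note E2 = cycle_weight_mean_asymp[where K = ?K and i = "(0, 0)" and r = "\<lambda>k. ?\<alpha> k * ?x k"
      and \<beta> = ?b and c = c2, folded E2_eq[OF fin, of x1 x2, folded c2_def]]
  show ?thesis
    unfolding J_def[symmetric] case_prod_beta
    using E1[OF _ _ _ _ c1] E2[OF _ _ _ _ c2] J x \<alpha>x
    by (auto simp: mult.assoc)
qed

end
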